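(* For any integers $r\geq 2$ and $t\geq 1$ there exists a constant $C=C(r,t)$ such that, for all sufficiently large $n$, $\mathrm{ex}_r(K_n,\mathcal{F}_t^r)\le C n^{2-1/t'}$, where $t'=t r^{r-1}$.
   Context: Let $k,t,r$ be positive integers. An $r$-edge-colored complete graph $H=K_{kt}$ belongs to the family $\mathcal{F}_t^r$ if there is a partition $V(H)=V_1\sqcup\dots\sqcup V_k$ with $|V_i|=t$ for all $i$ such that: (1) for all $i,j\in[k]$, the edges inside $V_i$ all have the same color, and the edges between $V_i$ and $V_j$ all have the same color; (2) all $r$ colors appear in $H$; (3) for no $i\in[k]$ do all $r$ colors appear in $H\setminus V_i$. ($\mathcal{F}_t^r$ is the union over all $k$ of such graphs.) For a family $\mathcal{F}$ of $r$-edge-colored graphs, $\mathrm{ex}_r(K_n,\mathcal{F})$ denotes the minimum integer $m$ (if it exists) such that every $r$-edge-coloring of $K_n$ with more than $m$ edges in each of the $r$ colors contains a color-preserving copy of a member of $\mathcal{F}$; if no such $m$ exists it is $\infty$. *)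

theory Defs
  imports "HOL-Library.Ramsey" "HOL-Library.Extended_Real" "HOL-Library.Disjoint_Sets"
begin

record 'a ecgraph =
  verts :: "'a set"
  edges :: "'a set set"
  colour :: "'a set \<Rightarrow> nat"

(* The r colours are the naturals below r; a colouring need not use all of them. *)
definition edge_coloured_graph :: "nat \<Rightarrow> 'a ecgraph \<Rightarrow> bool" where
  "edge_coloured_graph r G \<longleftrightarrow>
     finite (verts G) \<and> edges G \<subseteq> nsets (verts G) 2 \<and> colour G \<in> edges G \<rightarrow> {..<r}"

definition edge_coloured_complete :: "nat \<Rightarrow> 'a ecgraph \<Rightarrow> bool" where
  "edge_coloured_complete r G \<longleftrightarrow> edge_coloured_graph r G \<and> edges G = nsets (verts G) 2"

definition colour_class :: "'a ecgraph \<Rightarrow> nat \<Rightarrow> 'a set set" where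
  "colour_class G a = {e \<in> edges G. colour G e = a}"

definition all_colours_appear :: "nat \<Rightarrow> 'a ecgraph \<Rightarrow> bool" where
  "all_colours_appear r G \<longleftrightarrow> (\<forall>a<r. colour_class G a \<noteq> {})"

definition delete_verts :: "'a ecgraph \<Rightarrow> 'a set \<Rightarrow> 'a ecgraph" where
  "delete_verts G S =
     \<lparr>verts = verts G - S, edges = {e \<in> edges G. e \<inter> S = {}}, colour = colour G\<rparr>"

definition contains_copy :: "'a ecgraph \<Rightarrow> 'b ecgraph \<Rightarrow> bool" where
  "contains_copy G H \<longleftrightarrow>
     (\<exists>\<phi>. inj_on \<phi> (verts H) \<and> \<phi> ` verts H \<subseteq> verts G \<and>
          (\<forall>e\<in>edges H. \<phi> ` e \<in> edges G \<and> colour G (\<phi> ` e) = colour H e))"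

(* The members have vertices in the type nat, which realises every finite
   edge-coloured graph up to isomorphism. *)
definition unavoidable_family :: "nat \<Rightarrow> nat \<Rightarrow> nat ecgraph set" where
  "unavoidable_family r t =
     {H. edge_coloured_complete r H \<and>
         (\<exists>k>0. \<exists>V :: nat \<Rightarrow> nat set.
            disjoint_family_on V {..<k} \<and> verts H = (\<Union>i<k. V i) \<and> (\<forall>i<k. card (V i) = t) \<and>
            (\<forall>i<k. \<exists>a. \<forall>e\<in>nsets (V i) 2. colour H e = a) \<and>
            (\<forall>i<k. \<forall>j<k. i \<noteq> j \<longrightarrow> (\<exists>a. \<forall>u\<in>V i. \<forall>v\<in>V j. colour H {u, v} = a)) \<and>
            all_colours_appear r H \<and>
            \<not> (\<exists>i<k. all_colours_appear r (delete_verts H (V i))))}"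

(* The infimum in enat is the minimum of a nonempty set, and \<infinity> for the empty set. *)
definition ex_coloured :: "nat \<Rightarrow> nat \<Rightarrow> 'a ecgraph set \<Rightarrow> enat" where
  "ex_coloured r n \<F> =
     Inf (enat ` {m. \<forall>G :: nat ecgraph.
            edge_coloured_complete r G \<and> verts G = {..<n} \<and>
            (\<forall>a<r. card (colour_class G a) > m)
            \<longrightarrow> (\<exists>H\<in>\<F>. contains_copy G H)})"

end

theory Submission
  imports Defs
begin

text \<open>
  Put \<open>d = t r\<^bsup>r-1\<^esup>\<close>. Dependent random choice in colour class \<open>a\<close> gives a large set \<open>U\<^sub>a\<close> all of whose
  \<open>d\<close>-subsets have many common neighbours in colour \<open>a\<close>. Ramsey's theorem yields \<open>d\<close>-sets
  \<open>A\<^sub>a \<subseteq> U\<^sub>a\<close> that are homogeneous inside and towards each other, and then, inside the common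
  neighbourhoods, \<open>t\<close>-sets \<open>B\<^sub>a\<close> that are homogeneous inside, towards each other and towards every single
  vertex of every \<open>A\<^sub>b\<close>. A vertex of \<open>A\<^sub>a\<close> sees \<open>B\<^sub>a\<close> in colour \<open>a\<close> and the other \<open>r - 1\<close> sets \<open>B\<^sub>b\<close> in one of
  \<open>r\<^bsup>r-1\<^esup>\<close> ways, so some \<open>t\<close> vertices of \<open>A\<^sub>a\<close> agree. The resulting \<open>2r\<close> parts are homogeneous and
  show every colour; a minimal subfamily with this property is a member of the family.
\<close>

section \<open>Ramsey's theorem for several colourings at once\<close>

text \<open>The colourings indexed by \<open>P\<close> merge into one whose colours are functions
  from \<open>P\<close> to \<open>{..<k}\<close>, so a single application of Ramsey's theorem for
  pairs serves all of them. The number \<open>N\<close> is fixed before the colourings are given.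
  This uniformity is what later makes the constant depend on \<open>r\<close> and \<open>t\<close>
  only.\<close>

lemma simultaneous_ramsey:
  fixes P :: "'p set" and k M :: nat
  assumes "finite P"
  obtains N :: nat where
    "\<And>f :: 'p \<Rightarrow> nat \<Rightarrow> nat \<Rightarrow> nat. (\<And>p x y. p \<in> P \<Longrightarrow> x < N \<Longrightarrow> y < N \<Longrightarrow> f p x y < k) \<Longrightarrow>
       \<exists>e c. (\<forall>x<M. e x < N) \<and> (\<forall>y<M. \<forall>x<y. e x < e y) \<and>
             (\<forall>p\<in>P. \<forall>y<M. \<forall>x<y. f p (e x) (e y) = c p)"
proof -
  define F where "F = P \<rightarrow>\<^sub>E {..<k}"
  have "finite F"
    using assms by (simp add: F_def finite_PiE)
  then obtain h where h: "bij_betw h F {0..<card F}"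
    using ex_bij_betw_finite_nat by blast
  obtain N :: nat where N: "partn_lst {..<N} (replicate (card F) M) 2"
    using ramsey_full by blast
  have "\<exists>e c. (\<forall>x<M. e x < N) \<and> (\<forall>y<M. \<forall>x<y. e x < e y) \<and>
             (\<forall>p\<in>P. \<forall>y<M. \<forall>x<y. f p (e x) (e y) = c p)"
    if f: "\<And>p x y. p \<in> P \<Longrightarrow> x < N \<Longrightarrow> y < N \<Longrightarrow> f p x y < k"
    for f :: "'p \<Rightarrow> nat \<Rightarrow> nat \<Rightarrow> nat"
  proof -
    define \<phi> where "\<phi> x y = (\<lambda>p\<in>P. f p x y)" for x y
    \<comment> \<open>Reading a 2-set as (minimum, maximum) lets the possibly asymmetric colourings
      \<open>f p\<close> be treated as colourings of unordered pairs.\<close>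
    define g where "g X = h (\<phi> (Min X) (Max X))" for X
    have \<phi>F: "\<phi> x y \<in> F" if "x < N" "y < N" for x y
      using f that by (auto simp: \<phi>_def F_def)
    have "g \<in> nsets {..<N} 2 \<rightarrow> {..<card F}"
    proof
      fix X assume "X \<in> nsets {..<N} 2"
      then obtain x y where "X = {x, y}" "x < N" "y < N"
        by (auto elim: nsets2_E)
      then have "\<phi> (Min X) (Max X) \<in> F"
        by (auto intro: \<phi>F simp: min_def max_def)
      with h show "g X \<in> {..<card F}"
        by (auto simp: g_def bij_betw_def)
    qed
    with N obtain i H where i: "i < card F" and H: "H \<in> nsets {..<N} M" and gi: "g ` nsets H 2 \<subseteq> {i}"
      by (elim partn_lstE) auto
    have H': "finite H" "card H = M" "H \<subseteq> {..<N}"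
      using H by (auto simp: nsets_def)
    define e where "e = enumerate H"
    have eH: "e x \<in> H" if "x < M" for x
      using that H' finite_enumerate_in_set unfolding e_def by blast
    have emono: "e x < e y" if "x < y" "y < M" for x y
      using that H' unfolding e_def by (simp add: finite_enumerate_mono)
    have eN: "e x < N" if "x < M" for x
      using eH[OF that] H' by auto
    have "\<phi> (e x) (e y) = inv_into F h i" if "x < y" "y < M" for x y
    proof -
      have lt: "e x < e y" "x < M"
        using emono that by auto
      have "{e x, e y} \<in> nsets H 2"
        using eH that lt by auto
      then have "g {e x, e y} = i"
        using gi by blast
      then have "h (\<phi> (e x) (e y)) = i"
        using lt by (simp add: g_def min_def max_def)
      moreover have "\<phi> (e x) (e y) \<in> F"
        using \<phi>F eN that lt by blast
      ultimately show ?thesis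
        using h by (metis bij_betw_def inv_into_f_f)
    qed
    then have "\<forall>p\<in>P. \<forall>y<M. \<forall>x<y. f p (e x) (e y) = inv_into F h i p"
      unfolding \<phi>_def by (metis restrict_apply')
    with eN emono show ?thesis
      by blast
  qed
  then show thesis
    using that by blast
qed

section \<open>Homogeneous sets and homogeneous blocks\<close>

text \<open>The bound \<open>c < r\<close> excludes the colour that \<open>diag_colouring\<close>
  reserves for equality. For such a colouring, sets that are homogeneous towards each other are
  therefore disjoint.\<close>

definition homogeneous_between :: "('a \<Rightarrow> 'a \<Rightarrow> nat) \<Rightarrow> nat \<Rightarrow> 'a set \<Rightarrow> 'a set \<Rightarrow> bool" where
  "homogeneous_between col r A B \<longleftrightarrow> (\<exists>c<r. \<forall>x\<in>A. \<forall>y\<in>B. col x y = c)"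

definition homogeneous_inside :: "('a \<Rightarrow> 'a \<Rightarrow> nat) \<Rightarrow> 'a set \<Rightarrow> bool" where
  "homogeneous_inside col A \<longleftrightarrow> (\<exists>c. \<forall>x\<in>A. \<forall>y\<in>A. x \<noteq> y \<longrightarrow> col x y = c)"

text \<open>The extra colour \<open>r\<close> marks equality, so that disjointness of parts becomes a statement about colours.\<close>
definition diag_colouring :: "nat \<Rightarrow> 'a set \<Rightarrow> ('a \<Rightarrow> 'a \<Rightarrow> nat) \<Rightarrow> bool" where
  "diag_colouring r V col \<longleftrightarrow>
     (\<forall>x\<in>V. \<forall>y\<in>V. col x y = col y x \<and> col x y \<le> r \<and> (col x y = r \<longleftrightarrow> x = y))"

text \<open>
  Ramsey is applied to pairs \<open>x < y\<close> of indices, coloured by the colours between all \<open>u i x\<close> and \<open>u j y\<close>.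
  Cutting the homogeneous index set into consecutive intervals, one per sequence, makes every pair of
  blocks comparable. Vertices of \<open>W\<close> enter as constant sequences.
\<close>
lemma homogeneous_blocks:
  fixes m l s r :: nat
  shows "\<exists>N :: nat. \<forall>(col :: 'a \<Rightarrow> 'a \<Rightarrow> nat) V u W.
       diag_colouring r V col \<and> (\<forall>i<m. inj_on (u i) {..<N} \<and> u i ` {..<N} \<subseteq> V) \<and>
       finite W \<and> card W \<le> l \<and> W \<subseteq> V \<longrightarrow>
         (\<exists>B. (\<forall>i<m. B i \<subseteq> u i ` {..<N} \<and> card (B i) = s \<and> homogeneous_inside col (B i)) \<and>
             (\<forall>i<m. \<forall>j<m. i \<noteq> j \<longrightarrow> homogeneous_between col r (B i) (B j)) \<and>
             (\<forall>i<m. \<forall>w\<in>W. homogeneous_between col r {w} (B i)))"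
proof -
  define P where "P = {..<m + l} \<times> {..<m + l}"
  \<comment> \<open>The first \<open>m * s\<close> indices are cut into \<open>m\<close> blocks of
    length \<open>s\<close>. The three additional ones guarantee the indices 0, 1, 2, which serve to
    exclude the equality colour, and an index \<open>m * s + 2\<close> beyond all blocks.\<close>
  define M where "M = m * s + 3"
  have "finite P"
    by (simp add: P_def)
  then obtain N where N: "\<And>f :: nat \<times> nat \<Rightarrow> nat \<Rightarrow> nat \<Rightarrow> nat.
      (\<And>p x y. p \<in> P \<Longrightarrow> x < N \<Longrightarrow> y < N \<Longrightarrow> f p x y < Suc r) \<Longrightarrow>
       \<exists>e c. (\<forall>x<M. e x < N) \<and> (\<forall>y<M. \<forall>x<y. e x < e y) \<and>
             (\<forall>p\<in>P. \<forall>y<M. \<forall>x<y. f p (e x) (e y) = c p)"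
    using simultaneous_ramsey[of P "Suc r" M] by blast
  have blocks: "\<exists>B. (\<forall>i<m. B i \<subseteq> u i ` {..<N} \<and> card (B i) = s \<and> homogeneous_inside col (B i)) \<and>
           (\<forall>i<m. \<forall>j<m. i \<noteq> j \<longrightarrow> homogeneous_between col r (B i) (B j)) \<and>
           (\<forall>i<m. \<forall>w\<in>W. homogeneous_between col r {w} (B i))"
    if col: "diag_colouring r V col" and inj: "\<And>i. i < m \<Longrightarrow> inj_on (u i) {..<N}"
      and uV: "\<And>i. i < m \<Longrightarrow> u i ` {..<N} \<subseteq> V"
      and W: "finite W" "card W \<le> l" "W \<subseteq> V"
    for col :: "'a \<Rightarrow> 'a \<Rightarrow> nat" and V u W
  proof -
    obtain w where w: "bij_betw w {0..<card W} W"
      using ex_bij_betw_nat_finite W(1) by blast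
    define z where "z i x = (if i < m then u i x else w ((i - m) mod card W))" for i x
    define I where "I = {..<m + card W}"
    have zV: "z i x \<in> V" if "i \<in> I" "x < N" for i x
    proof (cases "i < m")
      case True
      then show ?thesis using uV that by (auto simp: z_def)
    next
      case False
      with that have "(i - m) mod card W \<in> {0..<card W}"
        by (auto simp: I_def)
      then have "w ((i - m) mod card W) \<in> W"
        using w bij_betwE by blast
      with False W show ?thesis by (auto simp: z_def)
    qed
    \<comment> \<open>\<open>N\<close> was chosen for \<open>l\<close> extra vertices, but
      \<open>W\<close> may have fewer. Index pairs without a sequence receive the dummy colour
      0.\<close>
    define f where "f = (\<lambda>(i, j) x y. if i \<in> I \<and> j \<in> I then col (z i x) (z j y) else 0)"
    have fr: "f p x y < Suc r" if "p \<in> P" "x < N" "y < N" for p x y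
      using zV that col by (auto simp: f_def diag_colouring_def less_Suc_eq_le split: prod.splits)
    have "\<exists>e c. (\<forall>x<M. e x < N) \<and> (\<forall>y<M. \<forall>x<y. e x < e y) \<and>
             (\<forall>p\<in>P. \<forall>y<M. \<forall>x<y. f p (e x) (e y) = c p)"
      by (rule N) (rule fr)
    then obtain e c where
      ec: "\<forall>x<M. e x < N" "\<forall>y<M. \<forall>x<y. e x < e y" "\<forall>p\<in>P. \<forall>y<M. \<forall>x<y. f p (e x) (e y) = c p"
      by (elim exE conjE)
    have eN: "e x < N" if "x < M" for x
      using ec(1) that by blast
    have emono: "e x < e y" if "x < y" "y < M" for x y
      using ec(2) that by blast
    have fc: "f p (e x) (e y) = c p" if "p \<in> P" "x < y" "y < M" for p x y
      using ec(3) that by blast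
    have zc: "col (z i (e x)) (z j (e y)) = c (i, j)"
      if "i \<in> I" "j \<in> I" "x < y" "y < M" for i j x y
    proof -
      have "(i, j) \<in> P"
        using that W by (auto simp: P_def I_def)
      from fc[OF this that(3,4)] that show ?thesis
        by (simp add: f_def)
    qed
    have einj: "e x \<noteq> e y" if "x < M" "y < M" "x \<noteq> y" for x y
      using emono that by (metis less_irrefl linorder_neqE_nat)
    have uinj: "u i (e x) \<noteq> u i (e y)" if "i < m" "x < M" "y < M" "x \<noteq> y" for i x y
      using inj[OF that(1)] einj[OF that(2-4)] eN that by (auto simp: inj_on_def)
    have M3: "0 < M" "1 < M" "2 < M"
      by (auto simp: M_def)
    have uI: "z i x = u i x" "i \<in> I" if "i < m" for i x
      using that by (auto simp: z_def I_def)
    \<comment> \<open>Colour \<open>r\<close> encodes equality, which an injective sequence cannot sustain on two indices.\<close>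
    have cr: "c (i, j) < r" if i: "i \<in> I" and j: "j \<in> I" and ij: "i < m \<and> m \<le> j \<or> j < m \<and> i \<noteq> j" for i j
    proof -
      have zVe: "z i (e x) \<in> V" if "i \<in> I" "x < M" for i x
        using zV eN that by blast
      have le: "c (i, j) \<le> r"
        using zc[OF i j, of 0 1] M3 zVe i j col unfolding diag_colouring_def by (metis less_one)
      have "c (i, j) \<noteq> r"
      proof
        assume "c (i, j) = r"
        then have eq: "z i (e x) = z j (e y)" if "x < y" "y < M" for x y
          using zc[OF i j that] zVe i j that col less_trans unfolding diag_colouring_def by metis
        show False
        proof (cases "j < m")
          case True
          then show False
            using eq[of 0 1] eq[of 0 2] uinj[of j 1 2] M3 uI by auto
        next
          case False
          then have "i < m" using ij by auto
          moreover have "z j (e 2) = z j (e 1)"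
            using False by (simp add: z_def)
          ultimately show False
            using eq[of 0 2] eq[of 1 2] uinj[of i 0 1] M3 uI by auto
        qed
      qed
      with le show ?thesis by simp
    qed
    define B where "B i = (\<lambda>x. u i (e x)) ` {i * s..<Suc i * s}" for i
    have blk: "x < m * s" "x < M" if "i < m" "x \<in> {i * s..<Suc i * s}" for i x
    proof -
      have "Suc i * s \<le> m * s"
        using that(1) by (intro mult_le_mono1) simp
      with that show "x < m * s" "x < M"
        unfolding M_def by auto
    qed
    have sub: "B i \<subseteq> u i ` {..<N}" if "i < m" for i
      using blk[OF that] eN by (auto simp: B_def)
    have card: "card (B i) = s" if "i < m" for i
    proof -
      have "inj_on (\<lambda>x. u i (e x)) {i * s..<Suc i * s}"
        using uinj[OF that] blk[OF that] by (meson inj_onI)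
      then show ?thesis
        by (simp add: B_def card_image)
    qed
    have inside: "homogeneous_inside col (B i)" if "i < m" for i
    proof -
      have lt: "col (u i (e x)) (u i (e y)) = c (i, i)" "col (u i (e y)) (u i (e x)) = c (i, i)"
        if "x < y" "y < M" for x y
      proof -
        show *: "col (u i (e x)) (u i (e y)) = c (i, i)"
          using zc[of i i x y] that uI[OF \<open>i < m\<close>] by simp
        have "u i (e x) \<in> V" "u i (e y) \<in> V"
          using uV[OF \<open>i < m\<close>] eN that by auto
        with * col show "col (u i (e y)) (u i (e x)) = c (i, i)"
          unfolding diag_colouring_def by metis
      qed
      have "col a b = c (i, i)" if ab: "a \<in> B i" "b \<in> B i" "a \<noteq> b" for a b
      proof -
        obtain x y where xy: "a = u i (e x)" "b = u i (e y)" "x < M" "y < M"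
          using ab(1,2) blk[OF \<open>i < m\<close>] unfolding B_def by blast
        then have "x < y \<or> y < x"
          using ab(3) by (metis linorder_neqE_nat)
        with lt xy show ?thesis by auto
      qed
      then show ?thesis
        unfolding homogeneous_inside_def by blast
    qed
    have less: "col a b = c (i, j)" if ij: "i < j" "j < m" "a \<in> B i" "b \<in> B j" for a b i j
    proof -
      obtain x y where x: "a = u i (e x)" "x \<in> {i * s..<Suc i * s}"
        and y: "b = u j (e y)" "y \<in> {j * s..<Suc j * s}"
        using ij unfolding B_def by blast
      have "Suc i * s \<le> j * s"
        using that(1) by (intro mult_le_mono1) simp
      then have "x < y"
        using x y by auto
      then show ?thesis
        using zc[of i j x y] uI that blk x y by auto
    qed
    have between: "homogeneous_between col r (B i) (B j)" if "i < m" "j < m" "i \<noteq> j" for i j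
    proof (cases "i < j")
      case True
      then show ?thesis
        using less[OF True that(2)] cr[of i j] uI that
        unfolding homogeneous_between_def by blast
    next
      case False
      then have "j < i" using that by simp
      have "col a b = c (j, i)" if "a \<in> B i" "b \<in> B j" for a b
      proof -
        have "a \<in> V" "b \<in> V"
          using sub uV that \<open>i < m\<close> \<open>j < m\<close> by blast+
        with less[OF \<open>j < i\<close> \<open>i < m\<close> that(2,1)] col show ?thesis
          unfolding diag_colouring_def by metis
      qed
      then show ?thesis
        using cr[of j i] uI that unfolding homogeneous_between_def by blast
    qed
    have extra: "homogeneous_between col r {v} (B i)" if iv: "i < m" "v \<in> W" for i v
    proof -
      obtain q where q: "q < card W" "v = w q"
        using w iv(2) by (metis bij_betw_imp_surj_on imageE atLeastLessThan_iff)
      define j where "j = m + q"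
      have j: "j \<in> I" "m \<le> j" "\<And>x. z j x = v"
        using q by (auto simp: j_def I_def z_def)
      have "col v b = c (i, j)" if b: "b \<in> B i" for b
      proof -
        obtain x where x: "b = u i (e x)" "x \<in> {i * s..<Suc i * s}"
          using b unfolding B_def by blast
        \<comment> \<open>The sequence of \<open>v\<close> is constant, so \<open>v\<close> may be
          read off at the index \<open>m * s + 2\<close>, which follows every block index and still
          lies below \<open>M\<close>.\<close>
        have "x < m * s + 2" "m * s + 2 < M"
          using blk(1)[OF \<open>i < m\<close> x(2)] by (auto simp: M_def)
        then have "col b v = c (i, j)"
          using zc[of i j x "m * s + 2"] j x uI \<open>i < m\<close> by auto
        moreover have "b \<in> V" "v \<in> V"
          using sub uV that \<open>i < m\<close> \<open>v \<in> W\<close> W by blast+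
        ultimately show ?thesis
          using col unfolding diag_colouring_def by metis
      qed
      then show ?thesis
        using cr[of i j] uI that j unfolding homogeneous_between_def by blast
    qed
    show ?thesis
      by (intro exI[of _ B] conjI allI impI ballI sub card inside between extra)
  qed
  show ?thesis
    by (intro exI[of _ N] allI impI, elim conjE, rule blocks) auto
qed

section \<open>Dependent random choice in a dense colour\<close>

text \<open>
  Averages over \<open>d\<close>-tuples \<open>T\<close>: their common neighbourhoods have mean size at least \<open>(2S)\<^sup>d\<close> and contain
  at most \<open>S\<^sup>d\<close> bad \<open>d\<close>-sets on average; deleting one vertex from each bad set leaves \<open>S\<close> vertices.
\<close>
lemma dependent_random_choice:
  fixes R :: "'a \<Rightarrow> 'a \<Rightarrow> bool" and V :: "'a set" and d S :: nat
  assumes V: "finite V" "V \<noteq> {}" and d: "d \<ge> 1"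
    and deg: "(2 * S) ^ d * card V ^ d \<le> (\<Sum>v\<in>V. card {u \<in> V. R u v} ^ d)"
  obtains U where "U \<subseteq> V" "card U \<ge> S"
    "\<And>X. X \<in> nsets U d \<Longrightarrow> card {u \<in> V. \<forall>v\<in>X. R u v} \<ge> S"
proof (cases "S = 0")
  case True
  then show thesis using that[of "{}"] by simp
next
  case False
  \<comment> \<open>Tuples may repeat entries, so exactly \<open>card Y ^ d\<close> of them have all
    entries in a given subset \<open>Y\<close> of \<open>V\<close>.\<close>
  define \<T> where "\<T> = {T. set T \<subseteq> V \<and> length T = d}"
  define com where "com T = {v \<in> V. \<forall>u\<in>set T. R u v}" for T
  define bad where "bad = {X \<in> nsets V d. card {u \<in> V. \<forall>v\<in>X. R u v} < S}"
  define badin where "badin T = {X \<in> bad. X \<subseteq> com T}" for T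
  have fT: "finite \<T>" and cT: "card \<T> = card V ^ d"
    using V by (auto simp: \<T>_def finite_lists_length_eq card_lists_length_eq)
  have fbad: "finite bad"
    unfolding bad_def using finite_imp_finite_nsets[OF V(1)] by simp
  have lists: "card {T \<in> \<T>. \<forall>u\<in>set T. Q u} = card {u \<in> V. Q u} ^ d" for Q
  proof -
    have "{T \<in> \<T>. \<forall>u\<in>set T. Q u} = {T. set T \<subseteq> {u \<in> V. Q u} \<and> length T = d}"
      by (auto simp: \<T>_def)
    then show ?thesis
      using V by (simp add: card_lists_length_eq)
  qed
  have "(\<Sum>T\<in>\<T>. card (com T)) = (\<Sum>v\<in>V. card {T \<in> \<T>. \<forall>u\<in>set T. R u v})"
    unfolding com_def using fT V by (intro sum_multicount_gen) auto
  also have "\<dots> = (\<Sum>v\<in>V. card {u \<in> V. R u v} ^ d)"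
    by (simp add: lists)
  finally have lower: "(2 * S) ^ d * card V ^ d \<le> (\<Sum>T\<in>\<T>. card (com T))"
    using deg by simp
  have "(\<Sum>T\<in>\<T>. card (badin T)) = (\<Sum>X\<in>bad. card {T \<in> \<T>. X \<subseteq> com T})"
    unfolding badin_def using fT fbad by (intro sum_multicount_gen) auto
  \<comment> \<open>A bad set lies in \<open>com T\<close> exactly when every entry of
    \<open>T\<close> is one of its fewer than \<open>S\<close> common neighbours.\<close>
  also have "\<dots> \<le> (\<Sum>X\<in>bad. S ^ d)"
  proof (rule sum_mono)
    fix X assume X: "X \<in> bad"
    then have "X \<subseteq> V"
      by (auto simp: bad_def nsets_def)
    then have "{T \<in> \<T>. X \<subseteq> com T} = {T \<in> \<T>. \<forall>u\<in>set T. \<forall>v\<in>X. R u v}"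
      by (auto simp: com_def)
    then have "card {T \<in> \<T>. X \<subseteq> com T} = card {u \<in> V. \<forall>v\<in>X. R u v} ^ d"
      by (simp add: lists)
    also have "\<dots> \<le> S ^ d"
      using X by (intro power_mono) (auto simp: bad_def)
    finally show "card {T \<in> \<T>. X \<subseteq> com T} \<le> S ^ d" .
  qed
  also have "\<dots> \<le> card V ^ d * S ^ d"
  proof -
    have "card bad \<le> card (nsets V d)"
      using V by (intro card_mono) (auto simp: bad_def intro: finite_imp_finite_nsets)
    also have "\<dots> \<le> card V ^ d"
      by (cases "d \<le> card V") (auto simp: binomial_le_pow binomial_eq_0)
    finally show ?thesis by simp
  qed
  finally have upper: "(\<Sum>T\<in>\<T>. card (badin T)) \<le> card V ^ d * S ^ d" .
  \<comment> \<open>If every \<open>T\<close> failed, summing over the \<open>card V ^ d\<close>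
    tuples would put the total of \<open>card (com T)\<close> below
    \<open>card V ^ d * (S ^ d + S)\<close>. Since \<open>S \<le> S ^ d\<close> and
    \<open>2 \<le> 2 ^ d\<close>, this is at most \<open>(2 * S) ^ d * card V ^ d\<close>, against
    \<open>lower\<close>.\<close>
  have "\<exists>T\<in>\<T>. card (badin T) + S \<le> card (com T)"
  proof (rule ccontr)
    assume "\<not> ?thesis"
    then have "card (com T) < card (badin T) + S" if "T \<in> \<T>" for T
      using that by force
    moreover have "\<T> \<noteq> {}"
      using V cT by fastforce
    ultimately have "(\<Sum>T\<in>\<T>. card (com T)) < (\<Sum>T\<in>\<T>. card (badin T) + S)"
      using fT by (intro sum_strict_mono) auto
    also have "\<dots> \<le> card V ^ d * S ^ d + card V ^ d * S"
      using upper cT by (simp add: sum.distrib)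
    also have "\<dots> \<le> card V ^ d * S ^ d + card V ^ d * S ^ d"
      using d False by (simp add: self_le_power)
    also have "\<dots> = 2 * S ^ d * card V ^ d"
      by simp
    also have "\<dots> \<le> (2 * S) ^ d * card V ^ d"
      using d self_le_power[of "2::nat" d] by (simp add: power_mult_distrib)
    finally show False
      using lower by simp
  qed
  then obtain T where T: "T \<in> \<T>" "card (badin T) + S \<le> card (com T)"
    by blast
  have ne: "X \<noteq> {}" if "X \<in> bad" for X
    using that d by (auto simp: bad_def nsets_def)
  define U where "U = com T - (\<lambda>X. SOME x. x \<in> X) ` badin T"
  have fin: "finite (badin T)" "finite (com T)"
    using fbad V by (auto simp: badin_def com_def)
  have "card (com T) - card ((\<lambda>X. SOME x. x \<in> X) ` badin T) \<le> card U"
    unfolding U_def using fin by (intro diff_card_le_card_Diff) auto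
  moreover have "card ((\<lambda>X. SOME x. x \<in> X) ` badin T) \<le> card (badin T)"
    using fin by (intro card_image_le)
  ultimately have "S \<le> card U"
    using T by linarith
  moreover have "U \<subseteq> V"
    by (auto simp: U_def com_def)
  moreover have "card {u \<in> V. \<forall>v\<in>X. R u v} \<ge> S" if X: "X \<in> nsets U d" for X
  proof (rule ccontr)
    assume "\<not> ?thesis"
    moreover have "X \<in> nsets V d"
      using X nsets_mono[OF \<open>U \<subseteq> V\<close>] by blast
    ultimately have "X \<in> bad"
      by (simp add: bad_def)
    moreover have "X \<subseteq> U"
      using X by (simp add: nsets_def)
    ultimately have "X \<in> badin T" "(SOME x. x \<in> X) \<in> X"
      using ne by (auto simp: badin_def U_def some_in_eq)
    with \<open>X \<subseteq> U\<close> show False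
      unfolding U_def by blast
  qed
  ultimately show thesis
    using that by blast
qed

text \<open>A power mean inequality that gives away a factor \<open>2 ^ d\<close> and thereby avoids
  convexity. With \<theta> equal to half of the lower bound \<open>m / card V\<close> on the mean,
  \<open>x ^ d \<ge> \<theta> ^ (d - 1) * (x - \<theta>)\<close> holds pointwise: by monotonicity
  above \<theta>, and because the right side is nonpositive below it. Summation gives the
  claim.\<close>

lemma power_sum_lower_bound:
  fixes x :: "'a \<Rightarrow> real" and m :: real
  assumes "finite V" "V \<noteq> {}" "\<And>v. v \<in> V \<Longrightarrow> x v \<ge> 0" "m \<ge> 0" "m \<le> sum x V" "d \<ge> 1"
  shows "real (card V) * (m / (2 * real (card V))) ^ d \<le> (\<Sum>v\<in>V. x v ^ d)"
proof -
  define n where "n = real (card V)"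
  define \<theta> where "\<theta> = m / (2 * n)"
  have n: "n > 0"
    using assms by (simp add: n_def card_gt_0_iff)
  have \<theta>: "\<theta> \<ge> 0" "2 * n * \<theta> = m"
    using n assms by (auto simp: \<theta>_def)
  obtain k where k: "d = Suc k"
    using \<open>d \<ge> 1\<close> by (metis Suc_le_D One_nat_def)
  have "n * \<theta> ^ d = \<theta> ^ k * (m - n * \<theta>)"
    using \<theta> by (auto simp: k algebra_simps)
  also have "\<dots> \<le> \<theta> ^ k * (sum x V - n * \<theta>)"
    using \<theta> assms by (intro mult_left_mono) auto
  also have "\<dots> = (\<Sum>v\<in>V. \<theta> ^ k * (x v - \<theta>))"
    by (simp add: sum_subtractf sum_distrib_left n_def right_diff_distrib)
  also have "\<dots> \<le> (\<Sum>v\<in>V. x v ^ d)"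
  proof (rule sum_mono)
    fix v assume v: "v \<in> V"
    show "\<theta> ^ k * (x v - \<theta>) \<le> x v ^ d"
    proof (cases "\<theta> \<le> x v")
      case True
      have "\<theta> ^ k * (x v - \<theta>) \<le> x v ^ k * x v"
        using True \<theta> by (intro mult_mono power_mono) auto
      then show ?thesis
        by (simp add: k mult.commute)
    next
      case False
      then have "\<theta> ^ k * (x v - \<theta>) \<le> 0"
        using \<theta> by (intro mult_nonneg_nonpos) auto
      also have "0 \<le> x v ^ d"
        using assms(3)[OF v] by simp
      finally show ?thesis .
    qed
  qed
  finally show ?thesis
    by (simp add: n_def \<theta>_def)
qed

text \<open>The value \<open>r\<close> on the diagonal turns the colouring of a complete graph into
  a \<open>diag_colouring\<close>. A colour below \<open>r\<close> thus already forces
  \<open>x \<noteq> y\<close>.\<close>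

definition edge_colour :: "nat \<Rightarrow> 'a ecgraph \<Rightarrow> 'a \<Rightarrow> 'a \<Rightarrow> nat" where
  "edge_colour r G x y = (if x = y then r else colour G {x, y})"

text \<open>With \<open>n\<close> vertices, the density makes the degree sum in colour
  \<open>a\<close> at least \<open>m = 4 * S * n powr (2 - 1 / d)\<close>. The exponent is chosen so
  that \<open>n * (m / (2 * n)) ^ d\<close> equals \<open>(2 * S) ^ d * n ^ d\<close>, which is what
  \<open>dependent_random_choice\<close> asks for. Of the factor 4, one 2 pays for the loss in
  \<open>power_sum_lower_bound\<close>, the other is the 2 in \<open>2 * S\<close>.\<close>

lemma dense_colour_dependent_random_choice:
  fixes G :: "'a ecgraph" and S d a r :: nat
  assumes G: "edge_coloured_complete r G" and "a < r" "d \<ge> 1" "verts G \<noteq> {}"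
    and dense: "real (card (colour_class G a)) \<ge> 4 * real S * real (card (verts G)) powr (2 - 1 / real d)"
  obtains U where "U \<subseteq> verts G" "card U \<ge> S"
    "\<And>X. X \<in> nsets U d \<Longrightarrow> card {u \<in> verts G. \<forall>v\<in>X. edge_colour r G u v = a} \<ge> S"
proof -
  define V where "V = verts G"
  define n where "n = real (card V)"
  define R where "R u v \<longleftrightarrow> edge_colour r G u v = a" for u v
  define m where "m = 4 * real S * n powr (2 - 1 / real d)"
  have V: "finite V" "V \<noteq> {}"
    using G assms by (auto simp: V_def edge_coloured_complete_def edge_coloured_graph_def)
  have n: "n > 0"
    using V by (simp add: n_def card_gt_0_iff)
  \<comment> \<open>A weak form of the handshake lemma: every edge comes from an ordered adjacent
    pair, so the degree sum is at least the number of edges.\<close>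
  have "colour_class G a \<subseteq> (\<lambda>(v, u). {u, v}) ` (SIGMA v:V. {u \<in> V. R u v})"
  proof
    fix e assume e: "e \<in> colour_class G a"
    then have "e \<in> nsets V 2" and c: "colour G e = a"
      using G by (auto simp: colour_class_def edge_coloured_complete_def V_def)
    then obtain x y where xy: "e = {x, y}" "x \<in> V" "y \<in> V" "x \<noteq> y"
      by (auto elim: nsets2_E)
    then have "(y, x) \<in> (SIGMA v:V. {u \<in> V. R u v})"
      using c by (auto simp: R_def edge_colour_def)
    then show "e \<in> (\<lambda>(v, u). {u, v}) ` (SIGMA v:V. {u \<in> V. R u v})"
      using xy by force
  qed
  then have "card (colour_class G a) \<le> card (SIGMA v:V. {u \<in> V. R u v})"
    using V by (intro surj_card_le) auto
  also have "\<dots> = (\<Sum>v\<in>V. card {u \<in> V. R u v})"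
    using V by simp
  finally have "real (card (colour_class G a)) \<le> real (\<Sum>v\<in>V. card {u \<in> V. R u v})"
    by (simp only: of_nat_le_iff)
  moreover have "m \<le> real (card (colour_class G a))"
    using dense unfolding m_def n_def V_def .
  ultimately have "m \<le> (\<Sum>v\<in>V. real (card {u \<in> V. R u v}))"
    by simp
  then have *: "n * (m / (2 * n)) ^ d \<le> (\<Sum>v\<in>V. real (card {u \<in> V. R u v}) ^ d)"
    unfolding n_def using V \<open>d \<ge> 1\<close> by (intro power_sum_lower_bound) (auto simp: m_def)
  have "n powr (2 - 1 / real d) / n = n powr (1 - 1 / real d)"
    using n by (simp add: powr_diff field_simps powr_numeral power2_eq_square)
  then have "m / (2 * n) = 2 * real S * n powr (1 - 1 / real d)"
    using n by (simp add: m_def field_simps)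
  moreover have "n * (n powr (1 - 1 / real d)) ^ d = n ^ d"
  proof -
    have "(n powr (1 - 1 / real d)) ^ d = n powr (real d - 1)"
      using n \<open>d \<ge> 1\<close> by (simp add: powr_power algebra_simps)
    also have "\<dots> = n ^ d / n"
      using n by (simp add: powr_diff powr_realpow)
    finally show ?thesis
      using n by simp
  qed
  ultimately have "n * (m / (2 * n)) ^ d = (2 * real S) ^ d * n ^ d"
    by (simp add: power_mult_distrib)
  with * have "real ((2 * S) ^ d * card V ^ d) \<le> real (\<Sum>v\<in>V. card {u \<in> V. R u v} ^ d)"
    by (simp add: n_def)
  then have "(2 * S) ^ d * card V ^ d \<le> (\<Sum>v\<in>V. card {u \<in> V. R u v} ^ d)"
    by (simp only: of_nat_le_iff)
  from dependent_random_choice[OF V \<open>d \<ge> 1\<close> this] show thesis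
    using that unfolding R_def V_def by blast
qed

section \<open>From homogeneous parts to a member of the family\<close>

lemma diag_colouring_edge_colour:
  assumes "edge_coloured_complete r G"
  shows "diag_colouring r (verts G) (edge_colour r G)"
proof -
  have "colour G {x, y} < r" if "x \<in> verts G" "y \<in> verts G" "x \<noteq> y" for x y
  proof -
    have "{x, y} \<in> edges G"
      using assms that by (simp add: edge_coloured_complete_def)
    then show ?thesis
      using assms unfolding edge_coloured_complete_def edge_coloured_graph_def by blast
  qed
  then show ?thesis
    by (force simp: diag_colouring_def edge_colour_def insert_commute)
qed

text \<open>Among the subfamilies of \<open>\<P>\<close> whose union shows all colours, one with the
  fewest parts loses a colour whenever a part is deleted, as the last condition of the family
  demands. The vertices of \<open>G\<close> are natural numbers, so the induced subgraph is itself
  the member and the embedding is the identity.\<close>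

lemma contains_unavoidable_if_homogeneous_parts:
  fixes G :: "nat ecgraph"
  assumes G: "edge_coloured_complete r G" and "r \<ge> 1" and fin: "finite \<P>"
    and parts: "\<And>P. P \<in> \<P> \<Longrightarrow> P \<subseteq> verts G \<and> card P = t \<and> homogeneous_inside (edge_colour r G) P"
    and between: "\<And>P Q. P \<in> \<P> \<Longrightarrow> Q \<in> \<P> \<Longrightarrow> P \<noteq> Q \<Longrightarrow> homogeneous_between (edge_colour r G) r P Q"
    and colours: "\<And>a. a < r \<Longrightarrow> \<exists>u\<in>\<Union>\<P>. \<exists>v\<in>\<Union>\<P>. edge_colour r G u v = a"
  shows "\<exists>H\<in>unavoidable_family r t. contains_copy G H"
proof -
  define sub where "sub \<Q> = \<lparr>verts = \<Union>\<Q>, edges = nsets (\<Union>\<Q>) 2, colour = colour G\<rparr>" for \<Q>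
  \<comment> \<open>A common vertex would produce the diagonal colour \<open>r\<close>, while
    \<open>homogeneous_between\<close> admits only colours below \<open>r\<close>.\<close>
  have disj: "P \<inter> Q = {}" if "P \<in> \<P>" "Q \<in> \<P>" "P \<noteq> Q" for P Q
    using between[OF that] unfolding homogeneous_between_def edge_colour_def
    by (metis disjoint_iff less_irrefl)
  define good where "good \<Q> \<longleftrightarrow> \<Q> \<subseteq> \<P> \<and> all_colours_appear r (sub \<Q>)" for \<Q>
  have "good \<P>"
    unfolding good_def all_colours_appear_def
  proof (intro conjI allI impI)
    fix a assume "a < r"
    with colours obtain u v where uv: "u \<in> \<Union>\<P>" "v \<in> \<Union>\<P>" "edge_colour r G u v = a"
      by blast
    with \<open>a < r\<close> have "u \<noteq> v" "colour G {u, v} = a"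
      by (auto simp: edge_colour_def split: if_splits)
    with uv have "{u, v} \<in> colour_class (sub \<P>) a"
      unfolding colour_class_def sub_def by (simp del: Union_iff)
    then show "colour_class (sub \<P>) a \<noteq> {}"
      by blast
  qed simp
  define \<Q> where "\<Q> = arg_min card good"
  have Q: "good \<Q>" and Qmin: "\<And>\<Q>'. good \<Q>' \<Longrightarrow> card \<Q> \<le> card \<Q>'"
    using arg_min_nat_lemma[of good \<P> card] \<open>good \<P>\<close> unfolding \<Q>_def by blast+
  have QP: "\<Q> \<subseteq> \<P>" and finQ: "finite \<Q>"
    using Q fin finite_subset by (auto simp: good_def)
  have "\<Q> \<noteq> {}"
  proof
    assume "\<Q> = {}"
    with Q \<open>r \<ge> 1\<close> show False
      by (auto simp: good_def sub_def all_colours_appear_def colour_class_def nsets_empty_iff)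
  qed
  obtain h where h: "bij_betw h {0..<card \<Q>} \<Q>"
    using ex_bij_betw_nat_finite finQ by blast
  have hQ: "h i \<in> \<Q>" if "i < card \<Q>" for i
    using h that by (auto simp: bij_betw_def)
  have hP: "h i \<in> \<P>" if "i < card \<Q>" for i
    using hQ[OF that] QP by blast
  have hinj: "h i \<noteq> h j" if "i < card \<Q>" "j < card \<Q>" "i \<noteq> j" for i j
    using h that by (auto simp: bij_betw_def inj_on_def)
  have hU: "(\<Union>i<card \<Q>. h i) = \<Union>\<Q>"
    using h by (simp add: bij_betw_def lessThan_atLeast0)
  have QV: "\<Union>\<Q> \<subseteq> verts G"
    using parts QP by blast
  have edges: "nsets (\<Union>\<Q>) 2 \<subseteq> edges G"
    using nsets_mono[OF QV] G by (auto simp: edge_coloured_complete_def)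
  have "edge_coloured_complete r (sub \<Q>)"
    using G edges finite_subset[OF QV]
    unfolding edge_coloured_complete_def edge_coloured_graph_def sub_def by auto
  moreover have "\<exists>k>0. \<exists>V :: nat \<Rightarrow> nat set.
            disjoint_family_on V {..<k} \<and> verts (sub \<Q>) = (\<Union>i<k. V i) \<and> (\<forall>i<k. card (V i) = t) \<and>
            (\<forall>i<k. \<exists>a. \<forall>e\<in>nsets (V i) 2. colour (sub \<Q>) e = a) \<and>
            (\<forall>i<k. \<forall>j<k. i \<noteq> j \<longrightarrow> (\<exists>a. \<forall>u\<in>V i. \<forall>v\<in>V j. colour (sub \<Q>) {u, v} = a)) \<and>
            all_colours_appear r (sub \<Q>) \<and>
            \<not> (\<exists>i<k. all_colours_appear r (delete_verts (sub \<Q>) (V i)))"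
  proof (rule exI[of _ "card \<Q>"], rule conjI, goal_cases)
    case 1
    show ?case
      using finQ \<open>\<Q> \<noteq> {}\<close> by (simp add: card_gt_0_iff)
  next
    case 2
    show ?case
    proof (rule exI[of _ h], intro conjI allI impI)
      show "disjoint_family_on h {..<card \<Q>}"
        unfolding disjoint_family_on_def using disj hP hinj by auto
      show "verts (sub \<Q>) = (\<Union>i<card \<Q>. h i)"
        unfolding hU by (simp add: sub_def)
      show "card (h i) = t" if "i < card \<Q>" for i
        using parts hP that by blast
      show "\<exists>a. \<forall>e\<in>nsets (h i) 2. colour (sub \<Q>) e = a" if i: "i < card \<Q>" for i
      proof -
        obtain c where c: "\<forall>x\<in>h i. \<forall>y\<in>h i. x \<noteq> y \<longrightarrow> edge_colour r G x y = c"
          using parts[OF hP[OF i]] unfolding homogeneous_inside_def by blast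
        have "colour G e = c" if "e \<in> nsets (h i) 2" for e
          using that c by (elim nsets2_E) (auto simp: edge_colour_def)
        then show ?thesis
          by (auto simp: sub_def)
      qed
      show "\<exists>a. \<forall>u\<in>h i. \<forall>v\<in>h j. colour (sub \<Q>) {u, v} = a"
        if ij: "i < card \<Q>" "j < card \<Q>" "i \<noteq> j" for i j
      proof -
        obtain c where "c < r" and c: "\<forall>x\<in>h i. \<forall>y\<in>h j. edge_colour r G x y = c"
          using between[OF hP[OF ij(1)] hP[OF ij(2)] hinj[OF ij]] unfolding homogeneous_between_def by blast
        have "colour G {u, v} = c" if "u \<in> h i" "v \<in> h j" for u v
          using that c \<open>c < r\<close> unfolding edge_colour_def by (metis less_irrefl)
        then show ?thesis
          by (auto simp: sub_def)
      qed
      show "all_colours_appear r (sub \<Q>)"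
        using Q by (simp add: good_def)
      show "\<not> (\<exists>i<card \<Q>. all_colours_appear r (delete_verts (sub \<Q>) (h i)))"
      proof
        assume "\<exists>i<card \<Q>. all_colours_appear r (delete_verts (sub \<Q>) (h i))"
        then obtain i where i: "i < card \<Q>" and *: "all_colours_appear r (delete_verts (sub \<Q>) (h i))"
          by blast
        \<comment> \<open>As the parts are disjoint, deleting the vertices of \<open>h i\<close>
          amounts to removing the member \<open>h i\<close> from \<open>\<Q>\<close>, which would
          leave a smaller good family.\<close>
        have "\<Union>\<Q> - h i = \<Union>(\<Q> - {h i})"
          using disj hP[OF i] QP by blast
        then have "delete_verts (sub \<Q>) (h i) = sub (\<Q> - {h i})"
          by (auto simp: delete_verts_def sub_def nsets_def)
        with * QP have "good (\<Q> - {h i})"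
          by (auto simp: good_def)
        then have "card \<Q> \<le> card (\<Q> - {h i})"
          by (rule Qmin)
        with finQ hQ[OF i] show False
          by (meson card_Diff1_less leD)
      qed
    qed
  qed
  ultimately have "sub \<Q> \<in> unavoidable_family r t"
    unfolding unavoidable_family_def by blast
  moreover have "contains_copy G (sub \<Q>)"
    unfolding contains_copy_def using QV edges by (intro exI[of _ id]) (auto simp: sub_def)
  ultimately show ?thesis
    by blast
qed

section \<open>Finding the parts in a graph with dense colours\<close>

lemma inj_sequence_into:
  assumes "N \<le> card A" "finite A"
  obtains f :: "nat \<Rightarrow> 'a" where "inj_on f {..<N}" "f ` {..<N} \<subseteq> A"
proof -
  obtain h where h: "bij_betw h {0..<card A} A"
    using ex_bij_betw_nat_finite assms(2) by blast
  have "{..<N} \<subseteq> {0..<card A}"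
    using assms(1) by auto
  with h have "inj_on h {..<N}" "h ` {..<N} \<subseteq> A"
    unfolding bij_betw_def by (blast intro: inj_on_subset)+
  then show thesis
    using that by blast
qed

lemma unavoidable_if_colours_dense:
  fixes r t :: nat
  assumes r: "r \<ge> 1" and t: "t \<ge> 1"
  obtains C :: real where "C \<ge> 0" and
    "\<And>G :: nat ecgraph. \<lbrakk>edge_coloured_complete r G; verts G \<noteq> {};
       \<And>a. a < r \<Longrightarrow> real (card (colour_class G a)) \<ge>
         C * real (card (verts G)) powr (2 - 1 / real (t * r ^ (r - 1)))\<rbrakk> \<Longrightarrow>
       \<exists>H\<in>unavoidable_family r t. contains_copy G H"
proof -
  define d where "d = t * r ^ (r - 1)"
  have d: "d \<ge> 1"
    using r t by (simp add: d_def)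
  \<comment> \<open>First round of Ramsey: blocks of size \<open>d\<close>, which become the sets
    \<open>A a\<close>. There are no extra vertices yet, hence the bound 0 on
    \<open>card W\<close>.\<close>
  obtain N1 :: nat where N1: "\<forall>(col :: nat \<Rightarrow> nat \<Rightarrow> nat) V u W.
       diag_colouring r V col \<and> (\<forall>i<r. inj_on (u i) {..<N1} \<and> u i ` {..<N1} \<subseteq> V) \<and>
       finite W \<and> card W \<le> 0 \<and> W \<subseteq> V \<longrightarrow>
         (\<exists>B. (\<forall>i<r. B i \<subseteq> u i ` {..<N1} \<and> card (B i) = d \<and> homogeneous_inside col (B i)) \<and>
             (\<forall>i<r. \<forall>j<r. i \<noteq> j \<longrightarrow> homogeneous_between col r (B i) (B j)) \<and>
             (\<forall>i<r. \<forall>w\<in>W. homogeneous_between col r {w} (B i)))"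
    using homogeneous_blocks[of r r 0 d, where ?'a = nat] by (rule exE)
  \<comment> \<open>Second round: blocks of size \<open>t\<close>, which become the sets
    \<open>B a\<close>. The extra vertices are those of all \<open>A a\<close>, at most
    \<open>r * d\<close> in number.\<close>
  obtain N2 :: nat where N2: "\<forall>(col :: nat \<Rightarrow> nat \<Rightarrow> nat) V u W.
       diag_colouring r V col \<and> (\<forall>i<r. inj_on (u i) {..<N2} \<and> u i ` {..<N2} \<subseteq> V) \<and>
       finite W \<and> card W \<le> r * d \<and> W \<subseteq> V \<longrightarrow>
         (\<exists>B. (\<forall>i<r. B i \<subseteq> u i ` {..<N2} \<and> card (B i) = t \<and> homogeneous_inside col (B i)) \<and>
             (\<forall>i<r. \<forall>j<r. i \<noteq> j \<longrightarrow> homogeneous_between col r (B i) (B j)) \<and>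
             (\<forall>i<r. \<forall>w\<in>W. homogeneous_between col r {w} (B i)))"
    using homogeneous_blocks[of r r "r * d" t, where ?'a = nat] by (rule exE)
  \<comment> \<open>Dependent random choice has to supply room for both rounds: \<open>N1\<close>
    vertices in the chosen set and \<open>N2\<close> common neighbours for each of its
    \<open>d\<close>-subsets. Since \<open>N1\<close> and \<open>N2\<close> do not depend on
    \<open>G\<close>, neither does the constant \<open>4 * S\<close>.\<close>
  define S where "S = max N1 N2"
  have "\<exists>H\<in>unavoidable_family r t. contains_copy G H"
    if G: "edge_coloured_complete r G" and ne: "verts G \<noteq> {}"
      and dense: "\<And>a. a < r \<Longrightarrow> real (card (colour_class G a)) \<ge>
         4 * real S * real (card (verts G)) powr (2 - 1 / real d)"
    for G :: "nat ecgraph"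
  proof -
    define col where "col = edge_colour r G"
    define V where "V = verts G"
    have diag: "diag_colouring r V col"
      unfolding V_def col_def by (rule diag_colouring_edge_colour[OF G])
    have sym: "col x y = col y x" if "x \<in> V" "y \<in> V" for x y
      using diag that by (auto simp: diag_colouring_def)
    have finV: "finite V"
      using G by (simp add: V_def edge_coloured_complete_def edge_coloured_graph_def)
    define com where "com a X = {u \<in> V. \<forall>v\<in>X. col u v = a}" for a X
    have "\<exists>u. inj_on u {..<N1} \<and> u ` {..<N1} \<subseteq> V \<and>
            (\<forall>X\<in>nsets (u ` {..<N1}) d. card (com a X) \<ge> S)" if a: "a < r" for a
    proof -
      obtain U where U: "U \<subseteq> V" "card U \<ge> S" "\<And>X. X \<in> nsets U d \<Longrightarrow> card (com a X) \<ge> S"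
        using dense_colour_dependent_random_choice[OF G a d ne dense[OF a]]
        unfolding com_def V_def col_def by blast
      have "N1 \<le> card U" "finite U"
        using U(2) finite_subset[OF U(1) finV] by (auto simp: S_def)
      then obtain u where u: "inj_on u {..<N1}" "u ` {..<N1} \<subseteq> U"
        by (rule inj_sequence_into)
      with U nsets_mono[OF u(2), of d] show ?thesis
        by blast
    qed
    then obtain u where u: "\<And>a. a < r \<Longrightarrow> inj_on (u a) {..<N1}"
        "\<And>a. a < r \<Longrightarrow> u a ` {..<N1} \<subseteq> V"
        "\<And>a X. a < r \<Longrightarrow> X \<in> nsets (u a ` {..<N1}) d \<Longrightarrow> card (com a X) \<ge> S"
      by metis
    have "\<exists>A. (\<forall>i<r. A i \<subseteq> u i ` {..<N1} \<and> card (A i) = d \<and> homogeneous_inside col (A i)) \<and>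
           (\<forall>i<r. \<forall>j<r. i \<noteq> j \<longrightarrow> homogeneous_between col r (A i) (A j)) \<and>
           (\<forall>i<r. \<forall>w\<in>{}. homogeneous_between col r {w} (A i))"
      by (rule N1[rule_format, of V]) (use diag u in auto)
    then obtain A where A0: "\<forall>i<r. A i \<subseteq> u i ` {..<N1} \<and> card (A i) = d \<and> homogeneous_inside col (A i)"
        "\<forall>i<r. \<forall>j<r. i \<noteq> j \<longrightarrow> homogeneous_between col r (A i) (A j)"
        "\<forall>i<r. \<forall>w\<in>{}. homogeneous_between col r {w} (A i)"
      by (elim exE conjE)
    have A: "A i \<subseteq> u i ` {..<N1}" "card (A i) = d" "homogeneous_inside col (A i)" if "i < r" for i
      using A0(1) that by auto
    have AV: "A a \<subseteq> V" if "a < r" for a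
      using A(1) u(2) that by blast
    have finA: "finite (A a)" if "a < r" for a
      using AV[OF that] finV finite_subset by blast
    \<comment> \<open>The candidates for \<open>B a\<close> are common neighbours of
      \<open>A a\<close> in colour \<open>a\<close>. This fixes the colour between
      \<open>A a\<close> and \<open>B a\<close> and ensures that colour \<open>a\<close>
      appears.\<close>
    have "\<exists>b. inj_on b {..<N2} \<and> b ` {..<N2} \<subseteq> com a (A a)" if a: "a < r" for a
    proof -
      have "A a \<in> nsets (u a ` {..<N1}) d"
        using A(1,2) finA a by (simp add: nsets_def)
      then have "N2 \<le> card (com a (A a))" "finite (com a (A a))"
        using u(3)[OF a] finV by (auto simp: S_def com_def)
      then obtain b where "inj_on b {..<N2}" "b ` {..<N2} \<subseteq> com a (A a)"
        by (rule inj_sequence_into)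
      then show ?thesis
        by blast
    qed
    then obtain b where b: "\<And>a. a < r \<Longrightarrow> inj_on (b a) {..<N2}"
        "\<And>a. a < r \<Longrightarrow> b a ` {..<N2} \<subseteq> com a (A a)"
      by metis
    have bV: "b a ` {..<N2} \<subseteq> V" if "a < r" for a
      using b(2)[OF that] by (auto simp: com_def)
    define W where "W = (\<Union>a<r. A a)"
    have "card W \<le> (\<Sum>a<r. card (A a))"
      unfolding W_def by (rule card_UN_le) simp
    then have W: "card W \<le> r * d" "finite W" "W \<subseteq> V"
      using A(2) finA AV by (auto simp: W_def)
    have "\<exists>B. (\<forall>i<r. B i \<subseteq> b i ` {..<N2} \<and> card (B i) = t \<and> homogeneous_inside col (B i)) \<and>
           (\<forall>i<r. \<forall>j<r. i \<noteq> j \<longrightarrow> homogeneous_between col r (B i) (B j)) \<and>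
           (\<forall>i<r. \<forall>w\<in>W. homogeneous_between col r {w} (B i))"
      by (rule N2[rule_format, of V]) (use diag b(1) bV W in auto)
    then obtain B where B0: "\<forall>i<r. B i \<subseteq> b i ` {..<N2} \<and> card (B i) = t \<and> homogeneous_inside col (B i)"
        "\<forall>i<r. \<forall>j<r. i \<noteq> j \<longrightarrow> homogeneous_between col r (B i) (B j)"
        "\<forall>i<r. \<forall>w\<in>W. homogeneous_between col r {w} (B i)"
      by (elim exE conjE)
    have B: "B i \<subseteq> b i ` {..<N2}" "card (B i) = t" "homogeneous_inside col (B i)" if "i < r" for i
      using B0(1) that by auto
    have BV: "B a \<subseteq> V" if "a < r" for a
      using B(1) bV that by blast
    define c where "c w i = (SOME k. k < r \<and> (\<forall>y\<in>B i. col w y = k))" for w i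
    have c: "c w i < r \<and> (\<forall>y\<in>B i. col w y = c w i)" if "i < r" "w \<in> W" for w i
      unfolding c_def by (rule someI_ex) (use B0(3) that in \<open>auto simp: homogeneous_between_def\<close>)
    have AB: "col w y = a" if "a < r" "w \<in> A a" "y \<in> B a" for a w y
    proof -
      have "y \<in> com a (A a)"
        using B(1) b(2) that by blast
      with that(2) have "col y w = a" "y \<in> V"
        by (auto simp: com_def)
      with sym[of w y] AV that show ?thesis
        by auto
    qed
    have "\<exists>A'. A' \<subseteq> A a \<and> card A' = t \<and> (\<forall>b<r. homogeneous_between col r A' (B b))" if a: "a < r" for a
    proof -
      \<comment> \<open>The entry at \<open>a\<close> is left out because the colour towards
        \<open>B a\<close> is known. Only \<open>r ^ (r - 1)\<close> profiles remain, so among the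
        \<open>d = t * r ^ (r - 1)\<close> vertices of \<open>A a\<close> at least \<open>t\<close>
        share one.\<close>
      define profile where "profile w = (\<lambda>i\<in>{..<r} - {a}. c w i)" for w
      define \<Phi> where "\<Phi> = ({..<r} - {a}) \<rightarrow>\<^sub>E {..<r}"
      have AW: "A a \<subseteq> W"
        using a by (auto simp: W_def)
      have "profile w \<in> \<Phi>" if "w \<in> A a" for w
        unfolding profile_def \<Phi>_def restrict_PiE_iff using AW c that by blast
      then have "profile \<in> A a \<rightarrow> \<Phi>"
        by blast
      moreover have "finite \<Phi>" "\<Phi> \<noteq> {}"
        using a by (auto simp: \<Phi>_def finite_PiE PiE_eq_empty_iff)
      ultimately obtain \<tau> where \<tau>: "card (profile -` {\<tau>} \<inter> A a) * card \<Phi> \<ge> card (A a)"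
        using pigeonhole_card finA[OF a] by metis
      have "card \<Phi> = r ^ (r - 1)"
        using a by (simp add: \<Phi>_def card_PiE)
      with \<tau> A(2)[OF a] r have "t \<le> card (profile -` {\<tau>} \<inter> A a)"
        by (simp add: d_def)
      then obtain A' where A': "A' \<subseteq> profile -` {\<tau>} \<inter> A a" "card A' = t"
        by (meson obtain_subset_with_card_n)
      have "homogeneous_between col r A' (B b)" if "b < r" for b
      proof (cases "b = a")
        case True
        then show ?thesis
          using AB[OF a] A' a unfolding homogeneous_between_def by blast
      next
        case False
        have "A' \<noteq> {}"
          using A' t by auto
        then obtain w0 where w0: "w0 \<in> A'"
          by blast
        have "c w b = c w0 b" if "w \<in> A'" for w
        proof -
          have "profile w = \<tau>" "profile w0 = \<tau>"
            using A'(1) that w0 by blast+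
          then have "profile w b = profile w0 b"
            by simp
          then show ?thesis
            using False \<open>b < r\<close> by (simp add: profile_def)
        qed
        moreover have "col w y = c w b" if "w \<in> A'" "y \<in> B b" for w y
          using c[OF \<open>b < r\<close>] A'(1) AW that by blast
        ultimately have "\<forall>w\<in>A'. \<forall>y\<in>B b. col w y = c w0 b"
          by simp
        moreover have "c w0 b < r"
          using c[OF \<open>b < r\<close>] w0 A' AW by blast
        ultimately show ?thesis
          unfolding homogeneous_between_def by blast
      qed
      then show ?thesis
        using A' by blast
    qed
    then obtain A' where A'0: "\<forall>a<r. A' a \<subseteq> A a \<and> card (A' a) = t \<and> (\<forall>b<r. homogeneous_between col r (A' a) (B b))"
      by metis
    then have A': "A' a \<subseteq> A a" "card (A' a) = t" "b < r \<Longrightarrow> homogeneous_between col r (A' a) (B b)"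
      if "a < r" for a b
      using that by auto
    define \<P> where "\<P> = A' ` {..<r} \<union> B ` {..<r}"
    have PV: "P \<subseteq> V" if "P \<in> \<P>" for P
      using that A'(1) AV BV unfolding \<P>_def by blast
    have swap: "homogeneous_between col r Q P"
      if "homogeneous_between col r P Q" "P \<subseteq> V" "Q \<subseteq> V" for P Q
      using that sym unfolding homogeneous_between_def by (metis subsetD)
    have AA: "homogeneous_between col r (A' i) (A' j)" if "i < r" "j < r" "i \<noteq> j" for i j
      using A0(2)[rule_format, OF that] A'(1) that unfolding homogeneous_between_def by (meson subsetD)
    have inside: "homogeneous_inside col (A' a)" if "a < r" for a
      using A(3)[OF that] A'(1)[OF that] unfolding homogeneous_inside_def by (meson subsetD)
    show ?thesis
    proof (rule contains_unavoidable_if_homogeneous_parts[OF G r, of \<P>])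
      show "finite \<P>"
        by (simp add: \<P>_def)
      show "P \<subseteq> verts G \<and> card P = t \<and> homogeneous_inside (edge_colour r G) P" if "P \<in> \<P>" for P
        using that PV[OF that] A'(2) B(2,3) inside unfolding \<P>_def V_def col_def by auto
      show "homogeneous_between (edge_colour r G) r P Q"
        if PQ: "P \<in> \<P>" "Q \<in> \<P>" "P \<noteq> Q" for P Q
      proof -
        consider i j where "P = A' i" "Q = A' j" "i < r" "j < r" | i j where "P = A' i" "Q = B j" "i < r" "j < r"
          | i j where "P = B i" "Q = A' j" "i < r" "j < r" | i j where "P = B i" "Q = B j" "i < r" "j < r"
          using PQ(1,2) unfolding \<P>_def by blast
        then have "homogeneous_between col r P Q"
        proof cases
          case (1 i j)
          then show ?thesis using AA[of i j] PQ(3) by auto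
        next
          case (2 i j)
          then show ?thesis using A'(3) by simp
        next
          case (3 i j)
          then show ?thesis using swap[OF A'(3)[of j i]] PV PQ(1,2) by simp
        next
          case (4 i j)
          then show ?thesis using B0(2) PQ(3) by auto
        qed
        then show ?thesis
          by (simp add: col_def)
      qed
      show "\<exists>u\<in>\<Union>\<P>. \<exists>v\<in>\<Union>\<P>. edge_colour r G u v = a" if a: "a < r" for a
      proof -
        have "A' a \<noteq> {}" "B a \<noteq> {}"
          using A'(2)[OF a] B(2)[OF a] t by auto
        then obtain w y where "w \<in> A' a" "y \<in> B a"
          by blast
        moreover have "A' a \<in> \<P>" "B a \<in> \<P>"
          using a by (auto simp: \<P>_def)
        ultimately show ?thesis
          using AB[OF a] A'(1)[OF a] unfolding col_def by blast
      qed
    qed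
  qed
  then show thesis
    using that[of "4 * real S"] unfolding d_def by simp
qed

section \<open>The bound on the extremal number\<close>

theorem theorem1p6:
  fixes r t :: nat
  assumes "r \<ge> 2" and "t \<ge> 1"
  shows "\<exists>C :: real. \<forall>\<^sub>F n in sequentially.
           ereal_of_enat (ex_coloured r n (unavoidable_family r t))
             \<le> ereal (C * real n powr (2 - 1 / real (t * r ^ (r - 1))))"
proof -
  have "r \<ge> 1"
    using assms by simp
  then obtain C :: real where C: "C \<ge> 0"
    "\<And>G :: nat ecgraph. \<lbrakk>edge_coloured_complete r G; verts G \<noteq> {};
       \<And>a. a < r \<Longrightarrow> real (card (colour_class G a)) \<ge>
         C * real (card (verts G)) powr (2 - 1 / real (t * r ^ (r - 1)))\<rbrakk> \<Longrightarrow>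
       \<exists>H\<in>unavoidable_family r t. contains_copy G H"
    using unavoidable_if_colours_dense[of r t] assms(2) by blast
  \<comment> \<open>The assumption \<open>n \<ge> 1\<close> makes the vertex set
    \<open>{..<n}\<close> nonempty.\<close>
  have "ereal_of_enat (ex_coloured r n (unavoidable_family r t))
      \<le> ereal (C * real n powr (2 - 1 / real (t * r ^ (r - 1))))" if n: "n \<ge> 1" for n
  proof -
    define b where "b = C * real n powr (2 - 1 / real (t * r ^ (r - 1)))"
    have "b \<ge> 0"
      using C(1) by (simp add: b_def)
    \<comment> \<open>The extremal number is an integer, so \<open>b\<close> is rounded down. More
      than \<open>m\<close> edges means at least \<open>m + 1 > b\<close> of them, which is the
      density required, and \<open>m \<le> b\<close> gives the final bound.\<close>
    define m where "m = nat \<lfloor>b\<rfloor>"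
    have m: "real m \<le> b" "b < real m + 1"
      using \<open>b \<ge> 0\<close> by (auto simp: m_def)
    have "\<exists>H\<in>unavoidable_family r t. contains_copy G H"
      if "edge_coloured_complete r G" "verts G = {..<n}" "\<forall>a<r. card (colour_class G a) > m"
      for G :: "nat ecgraph"
    proof (rule C(2))
      show "C * real (card (verts G)) powr (2 - 1 / real (t * r ^ (r - 1))) \<le> real (card (colour_class G a))"
        if "a < r" for a
      proof -
        have "m + 1 \<le> card (colour_class G a)"
          using \<open>\<forall>a<r. card (colour_class G a) > m\<close> that by force
        then have "real m + 1 \<le> real (card (colour_class G a))"
          by linarith
        with m(2) show ?thesis
          using \<open>verts G = {..<n}\<close> by (simp add: b_def)
      qed
    qed (use that n in \<open>auto simp: lessThan_empty_iff\<close>)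
    then have "ex_coloured r n (unavoidable_family r t) \<le> enat m"
      unfolding ex_coloured_def by (intro Inf_lower imageI) blast
    then have "ereal_of_enat (ex_coloured r n (unavoidable_family r t)) \<le> ereal_of_enat (enat m)"
      by (simp only: ereal_of_enat_le_iff)
    also have "\<dots> \<le> ereal b"
      using m(1) by simp
    finally show ?thesis
      by (simp add: b_def)
  qed
  then show ?thesis
    by (intro exI[of _ C] eventually_mono[OF eventually_ge_at_top[of 1]])
qed

end
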